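(* Let $K$ be a field and let $\mathcal{F}=K[\alpha,\beta:\alpha^2=\beta^2=0]$. If $f\in K\langle X^{\pm1},Y^{\pm1}\rangle$ is a non-zero Laurent polynomial which is a Laurent polynomial identity of $\mathcal{U}(\mathcal{F})$, then $f_i=0$ for every $i\in\{1,2,3,4\}$, where $f_1,f_2,f_3,f_4\in K$ are the elements associated to $f$ defined in the context.
   Context: $\mathcal{F}$ is the quotient of the free associative $K$-algebra on non-commuting variables $\alpha,\beta$ by the ideal generated by $\alpha^2$ and $\beta^2$; $\mathcal{U}(\mathcal{F})$ is its group of units. $F=\langle X^{\pm1},Y^{\pm1}\rangle$ is the free group on $X,Y$ and $K\langle X^{\pm1},Y^{\pm1}\rangle=KF$ is its group algebra. $f\in KF$ is a Laurent polynomial identity of $\mathcal{U}(\mathcal{F})$ if $f(u,v)=0$ for all $u,v\in\mathcal{U}(\mathcal{F})$. Every $w\in F$ has a unique normal form $$w=X^{n_0}Y^{m_1}X^{n_1}\cdots Y^{m_{k-1}}X^{n_{k-1}}Y^{m_k}X^{n_k},$$ where $k\ge 0$, $n_0,n_k$ are integers and $m_1,n_1,\dots,m_{k-1},n_{k-1},m_k$ are non-zero integers. A subword of $w$ is a block of consecutive syllables of this form, i.e. one of $X^{n_{i-1}}Y^{m_i}X^{n_i}\cdots Y^{m_j}$, $X^{n_{i-1}}Y^{m_i}X^{n_i}\cdots Y^{m_j}X^{n_j}$, $Y^{m_i}X^{n_i}\cdots Y^{m_j}$, $Y^{m_i}X^{n_i}\cdots Y^{m_j}X^{n_j}$ with $1\le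 i\le j\le k$ (subwords are counted by position). For $w\neq1$, the beginning $B(w)$ is $X$ if $n_0>0$; $X^{-1}$ if $n_0<0$; $Y$ if $n_0=0$ and $m_1>0$; $Y^{-1}$ if $n_0=0$ and $m_1<0$. The end $E(w)$ is $X$ if $n_k>0$; $X^{-1}$ if $n_k<0$; $Y$ if $n_k=0$ and $m_k>0$; $Y^{-1}$ if $n_k=0$ and $m_k<0$. Also $B(1)=E(1)=1$. Set $\mathrm{sgn}(w)=(-1)^{N(w)}$, where $N(w)$ is the number of subwords of $w$ of the form $X^nY^m$ or $Y^mX^n$ with $n>0$ and $m<0$. The cumulus of $w$ is $C(w)=\sum_{i=0}^k|n_i|+\sum_{i=1}^k|m_i|-M$, where $M$ is the number of subwords of $w$ of the form $X^nY^m$ or $Y^nX^m$ with $n<0$ and $m>0$. For $0\ne f=\sum_{w\in F}f_ww\in KF$ (with $f_w\in K$), let $\mathrm{Supp}(f)=\{w\in F: f_w\neq0\}$, $C(f)=\max\{C(w):w\in\mathrm{Supp}(f)\}$, and for $b,e\in\{X,X^{-1},Y,Y^{-1}\}$ let $$f_{b,e}=\sum_{\substack{C(w)=C(f)\\ B(w)=b,\ E(w)=e}}\mathrm{sgn}(w)f_w.$$ Define $$f_1=f_{X,X}+f_{X,Y}+f_{Y,X}+f_{Y,Y}-f_{Y^{-1},X}-f_{Y^{-1},Y},$$ $$f_2=f_{X,X^{-1}}+f_{X,Y}+f_{X,Y^{-1}}+f_{Y,X^{-1}}+f_{Y,Y}+f_{Y,Y^{-1}}-f_{Y^{-1},X^{-1}}-f_{Y^{-1},Y}-f_{Y^{-1},Y^{-1}},$$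 $$f_3=f_{X^{-1},X}+f_{X^{-1},Y}+f_{Y^{-1},X}+f_{Y^{-1},Y},$$ $$f_4=f_{X^{-1},X^{-1}}+f_{X^{-1},Y}+f_{X^{-1},Y^{-1}}+f_{Y^{-1},X^{-1}}+f_{Y^{-1},Y}+f_{Y^{-1},Y^{-1}}.$$ *)

theory Defs
  imports "HOL-Library.Poly_Mapping" "HOL.Hull"
begin

section \<open>The free group on two generators\<close>

datatype gen = GenX | GenY

text \<open>
  An element of the free group is represented by its normal form: the list of its syllables
  \<open>(g, n)\<close>, standing for \<open>g\<^sup>n\<close>, with non-zero exponents and alternating generators. The normal
  form that always starts and ends with a possibly trivial power of \<open>X\<close> corresponds to the list
  from which those trivial powers are omitted.
\<close>

definition reduced :: "(gen \<times> int) list \<Rightarrow> bool" where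
  "reduced ws \<longleftrightarrow> (\<forall>s\<in>set ws. snd s \<noteq> 0) \<and> successively (\<lambda>s t. fst s \<noteq> fst t) ws"

typedef fgroup = "{ws. reduced ws}"
  morphisms syllables Abs_fgroup
  by (rule exI[of _ "[]"]) (simp add: reduced_def)

setup_lifting type_definition_fgroup

text \<open>Multiplication from the left by a single syllable, with cancellation.\<close>

fun cons_syl :: "gen \<times> int \<Rightarrow> (gen \<times> int) list \<Rightarrow> (gen \<times> int) list" where
  "cons_syl (g, n) [] = (if n = 0 then [] else [(g, n)])"
| "cons_syl (g, n) ((h, m) # ws) =
    (if n = 0 then (h, m) # ws
     else if g \<noteq> h then (g, n) # (h, m) # ws
     else if n + m = 0 then ws
     else (g, n + m) # ws)"

lemma reduced_Nil [simp]: "reduced []"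
  by (simp add: reduced_def)

lemma reduced_Cons:
  "reduced (s # ws) \<longleftrightarrow> snd s \<noteq> 0 \<and> (ws = [] \<or> fst s \<noteq> fst (hd ws)) \<and> reduced ws"
  by (cases ws) (auto simp: reduced_def)

lemma reduced_cons_syl: "reduced ws \<Longrightarrow> reduced (cons_syl s ws)"
  by (cases "(s, ws)" rule: cons_syl.cases) (auto simp: reduced_Cons)

lemma reduced_foldr: "reduced b \<Longrightarrow> reduced (foldr cons_syl a b)"
  by (induction a) (auto intro: reduced_cons_syl)

lemma cons_syl_reduced: "reduced (s # ws) \<Longrightarrow> cons_syl s ws = s # ws"
  by (cases "(s, ws)" rule: cons_syl.cases) (auto simp: reduced_Cons)

lemma cons_syl_0: "cons_syl (g, 0) ws = ws"
  by (cases "((g, 0 :: int), ws)" rule: cons_syl.cases) auto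

lemma cons_syl_same:
  assumes "reduced ws"
  shows "cons_syl (g, n) (cons_syl (g, m) ws) = cons_syl (g, n + m) ws"
proof (cases ws)
  case Nil
  then show ?thesis by auto
next
  case (Cons s ws')
  obtain h k where s: "s = (h, k)" by (cases s)
  have k: "k \<noteq> 0" and h: "ws' = [] \<or> h \<noteq> fst (hd ws')"
    using assms Cons s by (auto simp: reduced_Cons)
  show ?thesis
  proof (cases ws')
    case Nil
    then show ?thesis using Cons s k by auto
  next
    case (Cons t ts)
    then obtain h' k' where "t = (h', k')" by (cases t)
    then show ?thesis using \<open>ws = s # ws'\<close> Cons s k h by auto
  qed
qed

lemma foldr_cons_syl:
  assumes "reduced b" "reduced c"
  shows "foldr cons_syl (cons_syl s b) c = cons_syl s (foldr cons_syl b c)"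
proof -
  obtain g n where s: "s = (g, n)" by (cases s)
  show ?thesis
  proof (cases b)
    case Nil
    then show ?thesis by (simp add: s cons_syl_0)
  next
    case (Cons t ts)
    obtain h m where t: "t = (h, m)" by (cases t)
    have red: "reduced (foldr cons_syl ts c)"
      using assms(2) by (rule reduced_foldr)
    show ?thesis
      using cons_syl_same[OF red, of h n m]
      by (auto simp: s Cons t cons_syl_0)
  qed
qed

lemma foldr_cons_syl_assoc:
  assumes "reduced b" "reduced c"
  shows "foldr cons_syl (foldr cons_syl a b) c = foldr cons_syl a (foldr cons_syl b c)"
  using assms by (induction a) (simp_all add: foldr_cons_syl reduced_foldr)

lemma foldr_cons_syl_Nil: "reduced a \<Longrightarrow> foldr cons_syl a [] = a"
  by (induction a) (simp_all add: reduced_Cons cons_syl_reduced)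

lemma foldr_cons_syl_inverse:
  "reduced a \<Longrightarrow> foldr cons_syl (rev (map (\<lambda>(g, n). (g, - n)) a)) a = []"
proof (induction a)
  case Nil
  then show ?case by simp
next
  case (Cons s a)
  obtain g n where s: "s = (g, n)" by (cases s)
  have "reduced a" using Cons.prems by (simp add: reduced_Cons)
  moreover have "cons_syl (g, - n) (s # a) = a"
    using Cons.prems by (simp add: s reduced_Cons)
  ultimately show ?case using Cons.IH by (simp add: s)
qed

lemma reduced_inverse:
  "reduced a \<Longrightarrow> reduced (rev (map (\<lambda>(g, n). (g, - n)) a))"
  unfolding reduced_def successively_rev successively_map
  by (auto simp: split_beta elim: successively_mono)

text \<open>
  Type class \<^class>\<open>group_add\<close> is the library's class of (not necessarily commutative) groups, in
  additive notation: \<open>0\<close>, \<open>+\<close> and unary \<open>-\<close> are the unit \<open>1\<close>, the product and the inverse of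
  the free group.
\<close>

instantiation fgroup :: group_add
begin

lift_definition zero_fgroup :: fgroup is "[]"
  by simp

lift_definition plus_fgroup :: "fgroup \<Rightarrow> fgroup \<Rightarrow> fgroup" is "foldr cons_syl"
  by (simp add: reduced_foldr)

lift_definition uminus_fgroup :: "fgroup \<Rightarrow> fgroup" is "\<lambda>a. rev (map (\<lambda>(g, n). (g, - n)) a)"
  by (simp add: reduced_inverse)

definition minus_fgroup :: "fgroup \<Rightarrow> fgroup \<Rightarrow> fgroup" where
  "minus_fgroup a b = a + - b"

instance
proof
  fix a b c :: fgroup
  show "a + b + c = a + (b + c)"
    by transfer (simp add: foldr_cons_syl_assoc)
  show "0 + a = a"
    by transfer simp
  show "a + 0 = a"
    by transfer (simp add: foldr_cons_syl_Nil)
  show "- a + a = 0"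
    by transfer (simp add: foldr_cons_syl_inverse)
  show "a + - b = a - b"
    by (simp add: minus_fgroup_def)
qed

end

lift_definition syl :: "gen \<Rightarrow> int \<Rightarrow> fgroup" is "\<lambda>g n. if n = 0 then [] else [(g, n)]"
  by (simp add: reduced_def)

abbreviation gX :: fgroup where "gX \<equiv> syl GenX 1"

abbreviation gY :: fgroup where "gY \<equiv> syl GenY 1"

lemma uminus_syl: "- syl g n = syl g (- n)"
  by transfer simp

text \<open>
  The group algebra \<open>K\<langle>X\<^sup>\<plusminus>\<^sup>1, Y\<^sup>\<plusminus>\<^sup>1\<rangle>\<close>. Multiplication of finitely supported functions is
  convolution over the (here non-commutative) group, \<^const>\<open>Poly_Mapping.keys\<close> is the support and
  \<^const>\<open>Poly_Mapping.lookup\<close> gives the coefficients.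
\<close>

type_synonym 'k laurent = "fgroup \<Rightarrow>\<^sub>0 'k"


section \<open>The algebra \<open>\<F>\<close> and its group of units\<close>

datatype var = Alpha | Beta

datatype monomial = Monomial "var list"

instantiation monomial :: monoid_add
begin

definition zero_monomial :: monomial where "zero_monomial = Monomial []"

fun plus_monomial :: "monomial \<Rightarrow> monomial \<Rightarrow> monomial" where
  "plus_monomial (Monomial u) (Monomial v) = Monomial (u @ v)"

instance
proof
  fix a b c :: monomial
  show "a + b + c = a + (b + c)" by (cases a; cases b; cases c) simp
  show "0 + a = a" by (cases a) (simp add: zero_monomial_def)
  show "a + 0 = a" by (cases a) (simp add: zero_monomial_def)
qed

end

type_synonym 'k free_algebra = "monomial \<Rightarrow>\<^sub>0 'k"

definition free_var :: "var \<Rightarrow> 'k::ring_1 free_algebra" where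
  "free_var x = Poly_Mapping.single (Monomial [x]) 1"

definition two_sided_ideal :: "'a::ring_1 set \<Rightarrow> bool" where
  "two_sided_ideal I \<longleftrightarrow> 0 \<in> I \<and> (\<forall>a\<in>I. \<forall>b\<in>I. a + b \<in> I) \<and> (\<forall>a\<in>I. \<forall>r. r * a \<in> I \<and> a * r \<in> I)"

definition square_ideal :: "'k::field free_algebra set" where
  "square_ideal = two_sided_ideal hull {free_var Alpha ^ 2, free_var Beta ^ 2}"

lemma two_sided_ideal_square_ideal: "two_sided_ideal square_ideal"
  unfolding square_ideal_def
  by (rule hull_in) (auto simp: two_sided_ideal_def)

lemma two_sided_idealD:
  assumes "two_sided_ideal I"
  shows "0 \<in> I" "a \<in> I \<Longrightarrow> b \<in> I \<Longrightarrow> a + b \<in> I" "a \<in> I \<Longrightarrow> r * a \<in> I" "a \<in> I \<Longrightarrow> a * r \<in> I"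
  using assms by (simp_all add: two_sided_ideal_def)

lemmas square_ideal_0 = two_sided_idealD(1)[OF two_sided_ideal_square_ideal]
  and square_ideal_add = two_sided_idealD(2)[OF two_sided_ideal_square_ideal]
  and square_ideal_mult_left = two_sided_idealD(3)[OF two_sided_ideal_square_ideal]
  and square_ideal_mult_right = two_sided_idealD(4)[OF two_sided_ideal_square_ideal]

lemma square_ideal_uminus: "a \<in> square_ideal \<Longrightarrow> - a \<in> square_ideal"
  using square_ideal_mult_left[of a "- 1"] by simp

lemma lookup_times_0:
  fixes p q :: "'k::field free_algebra"
  shows "Poly_Mapping.lookup (p * q) 0 = Poly_Mapping.lookup p 0 * Poly_Mapping.lookup q 0"
proof -
  have eq: "(0 = l + r) \<longleftrightarrow> l = 0 \<and> r = 0" for l r :: monomial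
    by (cases l; cases r) (auto simp: zero_monomial_def)
  have inner: "(\<Sum>r. Poly_Mapping.lookup q r when 0 = l + r) =
      (Poly_Mapping.lookup q 0 when l = 0)" for l :: monomial
  proof (cases "l = 0")
    case True
    then show ?thesis by (simp add: eq)
  next
    case False
    then show ?thesis by (simp add: eq)
  qed
  have "Poly_Mapping.lookup (p * q) 0 =
      (\<Sum>l. Poly_Mapping.lookup p l * (\<Sum>r. Poly_Mapping.lookup q r when 0 = l + r))"
    unfolding times_poly_mapping.rep_eq prod_fun_def ..
  also have "\<dots> = (\<Sum>l. (Poly_Mapping.lookup p l * Poly_Mapping.lookup q 0) when l = 0)"
    unfolding inner by (rule Sum_any.cong) (simp only: when_def mult_zero_right split: if_split, simp)
  also have "\<dots> = Poly_Mapping.lookup p 0 * Poly_Mapping.lookup q 0"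
    by simp
  finally show ?thesis .
qed

lemma one_notin_square_ideal: "(1 :: 'k::field free_algebra) \<notin> square_ideal"
proof -
  let ?I = "{p :: 'k free_algebra. Poly_Mapping.lookup p 0 = 0}"
  have "two_sided_ideal ?I"
    by (simp add: two_sided_ideal_def lookup_add lookup_times_0)
  moreover have "{free_var Alpha ^ 2, free_var Beta ^ 2} \<subseteq> ?I"
    by (auto simp: power2_eq_square lookup_times_0 free_var_def lookup_single when_def)
      (simp_all add: zero_monomial_def)
  ultimately have "square_ideal \<subseteq> ?I"
    unfolding square_ideal_def by (rule hull_minimal[rotated])
  moreover have "(1 :: 'k free_algebra) \<notin> ?I"
    by (simp add: lookup_one)
  ultimately show ?thesis by blast
qed

definition square_rel :: "'k::field free_algebra \<Rightarrow> 'k free_algebra \<Rightarrow> bool" where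
  "square_rel p q \<longleftrightarrow> p - q \<in> square_ideal"

quotient_type (overloaded) 'k falg = "'k::field free_algebra" / square_rel
proof (rule equivpI)
  show "reflp (square_rel :: 'k free_algebra \<Rightarrow> _)"
    by (rule reflpI) (simp add: square_rel_def square_ideal_0)
  show "symp (square_rel :: 'k free_algebra \<Rightarrow> _)"
    by (rule sympI) (metis square_rel_def square_ideal_uminus minus_diff_eq)
  show "transp (square_rel :: 'k free_algebra \<Rightarrow> _)"
  proof (rule transpI)
    fix p q r :: "'k free_algebra"
    assume "square_rel p q" "square_rel q r"
    then have "(p - q) + (q - r) \<in> square_ideal"
      unfolding square_rel_def by (rule square_ideal_add)
    then show "square_rel p r"
      by (simp add: square_rel_def)
  qed
qed

instantiation falg :: (field) ring_1
begin

lift_definition zero_falg :: "'a falg" is 0 .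

lift_definition one_falg :: "'a falg" is 1 .

lift_definition plus_falg :: "'a falg \<Rightarrow> 'a falg \<Rightarrow> 'a falg" is "(+)"
  unfolding square_rel_def
proof -
  fix a b c d :: "'a free_algebra"
  assume "a - b \<in> square_ideal" "c - d \<in> square_ideal"
  then have "(a - b) + (c - d) \<in> square_ideal"
    by (rule square_ideal_add)
  then show "a + c - (b + d) \<in> square_ideal"
    by (simp add: algebra_simps)
qed

lift_definition uminus_falg :: "'a falg \<Rightarrow> 'a falg" is uminus
  unfolding square_rel_def
proof -
  fix a b :: "'a free_algebra"
  assume "a - b \<in> square_ideal"
  then have "- (a - b) \<in> square_ideal"
    by (rule square_ideal_uminus)
  then show "- a - - b \<in> square_ideal"
    by simp
qed

lift_definition minus_falg :: "'a falg \<Rightarrow> 'a falg \<Rightarrow> 'a falg" is "(-)"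
  unfolding square_rel_def
proof -
  fix a b c d :: "'a free_algebra"
  assume "a - b \<in> square_ideal" "c - d \<in> square_ideal"
  then have "(a - b) + - (c - d) \<in> square_ideal"
    by (intro square_ideal_add square_ideal_uminus)
  then show "a - c - (b - d) \<in> square_ideal"
    by (simp add: algebra_simps)
qed

lift_definition times_falg :: "'a falg \<Rightarrow> 'a falg \<Rightarrow> 'a falg" is "(*)"
  unfolding square_rel_def
proof -
  fix a b c d :: "'a free_algebra"
  assume "a - b \<in> square_ideal" "c - d \<in> square_ideal"
  then have "(a - b) * c + b * (c - d) \<in> square_ideal"
    by (intro square_ideal_add square_ideal_mult_left square_ideal_mult_right)
  then show "a * c - b * d \<in> square_ideal"
    by (simp add: algebra_simps)
qed

instance
proof
  fix a b c :: "'a falg"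
  show "a + b + c = a + (b + c)"
    by transfer (simp add: square_rel_def square_ideal_0 algebra_simps)
  show "a + b = b + a"
    by transfer (simp add: square_rel_def square_ideal_0 algebra_simps)
  show "0 + a = a"
    by transfer (simp add: square_rel_def square_ideal_0)
  show "- a + a = 0"
    by transfer (simp add: square_rel_def square_ideal_0)
  show "a - b = a + - b"
    by transfer (simp add: square_rel_def square_ideal_0)
  show "a * b * c = a * (b * c)"
    by transfer (simp add: square_rel_def square_ideal_0 mult.assoc)
  show "1 * a = a"
    by transfer (simp add: square_rel_def square_ideal_0)
  show "a * 1 = a"
    by transfer (simp add: square_rel_def square_ideal_0)
  show "(a + b) * c = a * c + b * c"
    by transfer (simp add: square_rel_def square_ideal_0 distrib_right)
  show "a * (b + c) = a * b + a * c"
    by transfer (simp add: square_rel_def square_ideal_0 distrib_left)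
  show "(0 :: 'a falg) \<noteq> 1"
  proof transfer
    show "\<not> square_rel (0 :: 'a free_algebra) 1"
      using one_notin_square_ideal square_ideal_uminus[of "- 1 :: 'a free_algebra"]
      by (auto simp: square_rel_def)
  qed
qed

end

text \<open>The structure map \<open>K \<rightarrow> \<F>\<close>; scalar multiplication by \<open>c\<close> is multiplication by its value at \<open>c\<close>.\<close>

lift_definition falg_const :: "'k::field \<Rightarrow> 'k falg" is "Poly_Mapping.single 0" .

definition is_inverse :: "'a::ring_1 \<Rightarrow> 'a \<Rightarrow> bool" where
  "is_inverse u v \<longleftrightarrow> u * v = 1 \<and> v * u = 1"

definition ring_units :: "'a::ring_1 set" where
  "ring_units = {u. \<exists>v. is_inverse u v}"

text \<open>Integer powers; only meaningful for units.\<close>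

definition unit_power :: "'a::ring_1 \<Rightarrow> int \<Rightarrow> 'a" where
  "unit_power u n = (if n \<ge> 0 then u ^ nat n else (THE v. is_inverse u v) ^ nat (- n))"


section \<open>Laurent polynomial identities\<close>

definition eval_word :: "'a::ring_1 \<Rightarrow> 'a \<Rightarrow> fgroup \<Rightarrow> 'a" where
  "eval_word u v w =
    prod_list (map (\<lambda>(g, n). unit_power (case g of GenX \<Rightarrow> u | GenY \<Rightarrow> v) n) (syllables w))"

definition eval_laurent :: "'k::field falg \<Rightarrow> 'k falg \<Rightarrow> 'k laurent \<Rightarrow> 'k falg" where
  "eval_laurent u v f =
    (\<Sum>w\<in>Poly_Mapping.keys f. falg_const (Poly_Mapping.lookup f w) * eval_word u v w)"

definition laurent_identity :: "'k::field laurent \<Rightarrow> bool" where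
  "laurent_identity f \<longleftrightarrow>
    (\<forall>u\<in>ring_units. \<forall>v\<in>ring_units. eval_laurent u v f = 0)"


section \<open>Beginning, end, sign and cumulus of a word\<close>

definition beginning :: "fgroup \<Rightarrow> fgroup" where
  "beginning w =
    (case syllables w of [] \<Rightarrow> 0 | s # _ \<Rightarrow> syl (fst s) (sgn (snd s)))"

definition ending :: "fgroup \<Rightarrow> fgroup" where
  "ending w =
    (case rev (syllables w) of [] \<Rightarrow> 0 | s # _ \<Rightarrow> syl (fst s) (sgn (snd s)))"

text \<open>The subwords consisting of two syllables, listed by position.\<close>

definition syllable_pairs :: "fgroup \<Rightarrow> ((gen \<times> int) \<times> (gen \<times> int)) list" where
  "syllable_pairs w = zip (syllables w) (tl (syllables w))"

text \<open>In \<open>word_sgn\<close> it is the exponent of \<open>X\<close> that is positive and that of \<open>Y\<close> that is negative,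
  in either order. In \<open>cumulus\<close> it is the first exponent that is negative and the second that is
  positive, whichever generator comes first.\<close>

definition word_sgn :: "fgroup \<Rightarrow> 'k::ring_1" where
  "word_sgn w = (- 1) ^ length (filter
    (\<lambda>((g, a), (h, b)). (g = GenX \<and> a > 0 \<and> h = GenY \<and> b < 0) \<or>
                        (g = GenY \<and> a < 0 \<and> h = GenX \<and> b > 0)) (syllable_pairs w))"

definition cumulus :: "fgroup \<Rightarrow> int" where
  "cumulus w = (\<Sum>s\<leftarrow>syllables w. \<bar>snd s\<bar>) - int (length (filter
    (\<lambda>((g, a), (h, b)). (g = GenX \<and> a < 0 \<and> h = GenY \<and> b > 0) \<or>
                        (g = GenY \<and> a < 0 \<and> h = GenX \<and> b > 0)) (syllable_pairs w)))"

definition laurent_cumulus :: "'k::zero laurent \<Rightarrow> int" where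
  "laurent_cumulus f = Max (cumulus ` Poly_Mapping.keys f)"

definition corner :: "'k::field laurent \<Rightarrow> fgroup \<Rightarrow> fgroup \<Rightarrow> 'k" where
  "corner f b e =
    (\<Sum>w | w \<in> Poly_Mapping.keys f \<and> cumulus w = laurent_cumulus f \<and> beginning w = b \<and> ending w = e.
      word_sgn w * Poly_Mapping.lookup f w)"

definition f1 :: "'k::field laurent \<Rightarrow> 'k" where
  "f1 f = corner f gX gX + corner f gX gY + corner f gY gX + corner f gY gY
    - corner f (- gY) gX - corner f (- gY) gY"

definition f2 :: "'k::field laurent \<Rightarrow> 'k" where
  "f2 f = corner f gX (- gX) + corner f gX gY + corner f gX (- gY)
    + corner f gY (- gX) + corner f gY gY + corner f gY (- gY)
    - corner f (- gY) (- gX) - corner f (- gY) gY - corner f (- gY) (- gY)"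

definition f3 :: "'k::field laurent \<Rightarrow> 'k" where
  "f3 f = corner f (- gX) gX + corner f (- gX) gY + corner f (- gY) gX + corner f (- gY) gY"

definition f4 :: "'k::field laurent \<Rightarrow> 'k" where
  "f4 f = corner f (- gX) (- gX) + corner f (- gX) gY + corner f (- gX) (- gY)
    + corner f (- gY) (- gX) + corner f (- gY) gY + corner f (- gY) (- gY)"

end

(*
  Write a, b for the classes of alpha and beta. The units u = (1 + bab)(1 + a) and
  v = (1 - b) u (1 + b) are sent by the representation a -> s E21, b -> E12 over K[s] to
  matrices whose powers have, at degree 2|n| in s, rank one idempotents x y^T as leading
  coefficients: the column x is (1,0), (0,1), (1,0), (-1,1) and the row y is (1,0), (0,1),
  (1,1), (0,1) for positive and negative powers of u and of v, in this order. At a junction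
  of two syllables y^T x is 1 or -1, which produces the sign of the word, or 0, exactly for
  the junctions subtracted in the cumulus; there the degree drops by 2, and the coefficient at
  the lower degree carries the sign. Hence the
  coefficient of f(u,v) at s^(2 C(f)) is the sum of sgn(w) f_w x y^T, with x read off from
  B(w) and y from E(w), over the words of cumulus C(f). Its entries are f_1, f_2, f_3, f_4.
*)
theory Submission
  imports Defs "HOL-Computational_Algebra.Polynomial"
begin

section \<open>Two by two matrices\<close>

datatype 'a mat2 = Mat2 (m11: 'a) (m12: 'a) (m21: 'a) (m22: 'a)

instantiation mat2 :: (ring_1) ring_1
begin

definition zero_mat2 :: "'a mat2" where "0 = Mat2 0 0 0 0"

definition one_mat2 :: "'a mat2" where "1 = Mat2 1 0 0 1"

definition plus_mat2 :: "'a mat2 \<Rightarrow> 'a mat2 \<Rightarrow> 'a mat2" where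
  "A + B = Mat2 (m11 A + m11 B) (m12 A + m12 B) (m21 A + m21 B) (m22 A + m22 B)"

definition minus_mat2 :: "'a mat2 \<Rightarrow> 'a mat2 \<Rightarrow> 'a mat2" where
  "A - B = Mat2 (m11 A - m11 B) (m12 A - m12 B) (m21 A - m21 B) (m22 A - m22 B)"

definition uminus_mat2 :: "'a mat2 \<Rightarrow> 'a mat2" where
  "- A = Mat2 (- m11 A) (- m12 A) (- m21 A) (- m22 A)"

definition times_mat2 :: "'a mat2 \<Rightarrow> 'a mat2 \<Rightarrow> 'a mat2" where
  "A * B = Mat2 (m11 A * m11 B + m12 A * m21 B) (m11 A * m12 B + m12 A * m22 B)
                (m21 A * m11 B + m22 A * m21 B) (m21 A * m12 B + m22 A * m22 B)"

instance
  by standard (simp_all add: zero_mat2_def one_mat2_def plus_mat2_def minus_mat2_def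
      uminus_mat2_def times_mat2_def algebra_simps)

end

lemmas mat2_defs = zero_mat2_def one_mat2_def plus_mat2_def minus_mat2_def uminus_mat2_def
  times_mat2_def

definition scalar_mat2 :: "'a::ring_1 \<Rightarrow> 'a mat2" where
  "scalar_mat2 c = Mat2 c 0 0 c"

definition outer :: "'a::ring_1 \<times> 'a \<Rightarrow> 'a \<times> 'a \<Rightarrow> 'a mat2" where
  "outer x y = Mat2 (fst x * fst y) (fst x * snd y) (snd x * fst y) (snd x * snd y)"

definition dot :: "'a::ring_1 \<times> 'a \<Rightarrow> 'a \<times> 'a \<Rightarrow> 'a" where
  "dot x y = fst x * fst y + snd x * snd y"

lemma scalar_mat2_mult: "scalar_mat2 (a * b) = scalar_mat2 a * scalar_mat2 b"
  by (simp add: scalar_mat2_def mat2_defs)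

lemma scalar_mat2_0: "scalar_mat2 0 = 0"
  by (simp add: scalar_mat2_def mat2_defs)

lemma scalar_mat2_1: "scalar_mat2 1 = 1"
  by (simp add: scalar_mat2_def mat2_defs)

lemma scalar_mat2_commute:
  fixes c :: "'a::comm_ring_1"
  shows "scalar_mat2 c * A = A * scalar_mat2 c"
  by (simp add: scalar_mat2_def mat2_defs mult.commute)

text \<open>The inner row times column is a scalar and can be pulled out. For adjacent syllables it
  is the contribution of their junction to the leading coefficient.\<close>

lemma outer_mult_scalar_outer:
  fixes x :: "'a::comm_ring_1 \<times> 'a"
  shows "outer x y * (scalar_mat2 c * outer z w) = scalar_mat2 (dot y z * c) * outer x w"
  by (simp add: outer_def dot_def scalar_mat2_def mat2_defs algebra_simps)


section \<open>Leading coefficients of polynomial matrices\<close>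

definition coeff_mat2 :: "'a::comm_ring_1 poly mat2 \<Rightarrow> nat \<Rightarrow> 'a mat2" where
  "coeff_mat2 M n = map_mat2 (\<lambda>p. coeff p n) M"

lemma coeff_mat2_0: "coeff_mat2 0 n = 0"
  by (simp add: coeff_mat2_def mat2_defs)

lemma coeff_mat2_add: "coeff_mat2 (A + B) n = coeff_mat2 A n + coeff_mat2 B n"
  by (cases A; cases B) (simp add: coeff_mat2_def mat2_defs)

lemma coeff_mat2_sum: "coeff_mat2 (sum g S) n = (\<Sum>x\<in>S. coeff_mat2 (g x) n)"
  by (induction S rule: infinite_finite_induct) (simp_all add: coeff_mat2_0 coeff_mat2_add)

lemma coeff_mat2_scalar:
  "coeff_mat2 (scalar_mat2 [:c:] * A) n = scalar_mat2 c * coeff_mat2 A n"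
  by (cases A) (simp add: coeff_mat2_def scalar_mat2_def mat2_defs)

text \<open>The coefficient \<open>A\<close> may be zero here, so that the degree is only bounded by \<open>n\<close>.\<close>

definition leads :: "nat \<Rightarrow> 'a::comm_ring_1 mat2 \<Rightarrow> 'a poly mat2 \<Rightarrow> bool" where
  "leads n A M \<longleftrightarrow> (\<forall>p\<in>set_mat2 M. degree p \<le> n) \<and> coeff_mat2 M n = A"

text \<open>If a degree stays strictly below its bound, the product has degree below
  \<open>m + n\<close> and both sides vanish. So leading coefficients multiply even when one of them
  is zero.\<close>

lemma coeff_mult_degree_bound:
  fixes p q :: "'a::comm_ring_1 poly"
  assumes "degree p \<le> m" "degree q \<le> n"
  shows "coeff (p * q) (m + n) = coeff p m * coeff q n"
proof (cases "degree p = m \<and> degree q = n")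
  case True
  then show ?thesis using coeff_mult_degree_sum by blast
next
  case False
  then have "degree p < m \<or> degree q < n" using assms by auto
  moreover have "degree (p * q) < m + n"
    using False assms degree_mult_le[of p q] by linarith
  ultimately show ?thesis by (auto simp: coeff_eq_0)
qed

lemma leads_mult:
  assumes "leads m A M" "leads n B N"
  shows "leads (m + n) (A * B) (M * N)"
proof -
  have deg: "degree (p * q + p' * q') \<le> m + n"
    if "degree p \<le> m" "degree q \<le> n" "degree p' \<le> m" "degree q' \<le> n" for p q p' q' :: "'a poly"
    using that by (intro degree_add_le order.trans[OF degree_mult_le]) auto
  show ?thesis
    using assms
    by (cases M; cases N)
      (auto simp: leads_def coeff_mat2_def times_mat2_def coeff_mult_degree_bound intro!: deg)
qed

lemma leads_1: "leads 0 1 1"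
  by (simp add: leads_def coeff_mat2_def one_mat2_def)

lemma leads_power:
  assumes "leads m A M" "A * A = A" "n > 0"
  shows "leads (m * n) A (M ^ n)"
  using assms(3)
proof (induction n rule: nat_induct_non_zero)
  case 1
  then show ?case using assms(1) by simp
next
  case (Suc n)
  then show ?case using leads_mult[OF assms(1) Suc.IH] assms(2) by (simp add: mult.commute)
qed

lemma leads_coeff_above: "leads n A M \<Longrightarrow> n < m \<Longrightarrow> coeff_mat2 M m = 0"
  by (cases M) (auto simp: leads_def coeff_mat2_def zero_mat2_def coeff_eq_0)


section \<open>Units and ring homomorphisms\<close>

text \<open>Two-sided inverses are unique, so the definite description in \<open>unit_power\<close>
  denotes \<open>v\<close>.\<close>

lemma unit_power_eq:
  assumes "is_inverse u v"
  shows "unit_power u n = (if n \<ge> 0 then u ^ nat n else v ^ nat (- n))"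
proof -
  have "w = v" if "is_inverse u w" for w
  proof -
    have "w = (v * u) * w" using assms by (simp add: is_inverse_def)
    also have "\<dots> = v" using that by (simp add: is_inverse_def mult.assoc)
    finally show ?thesis .
  qed
  then have "(THE v. is_inverse u v) = v"
    using assms by blast
  then show ?thesis by (simp add: unit_power_def)
qed

lemma is_inverse_mult:
  assumes "is_inverse a b" "is_inverse c d"
  shows "is_inverse (a * c) (d * b)"
proof -
  have "(a * c) * (d * b) = a * (c * d) * b" "(d * b) * (a * c) = d * (b * a) * c"
    by (simp_all only: mult.assoc)
  then show ?thesis using assms by (simp add: is_inverse_def)
qed

lemma is_inverse_sym: "is_inverse a b \<Longrightarrow> is_inverse b a"
  by (simp add: is_inverse_def)

lemma is_inverse_1_plus_square_zero:
  fixes x :: "'a::ring_1"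
  assumes "x * x = 0"
  shows "is_inverse (1 + x) (1 - x)"
  using assms by (simp add: is_inverse_def algebra_simps)

locale ring_1_hom =
  fixes h :: "'a::ring_1 \<Rightarrow> 'b::ring_1"
  assumes hom_add: "h (x + y) = h x + h y"
    and hom_mult: "h (x * y) = h x * h y"
    and hom_1: "h 1 = 1"
begin

lemma hom_0: "h 0 = 0"
  using hom_add[of 0 0] by simp

lemma hom_diff: "h (x - y) = h x - h y"
  using hom_add[of "x - y" y] by (simp add: algebra_simps)

lemma hom_sum: "h (sum g S) = (\<Sum>x\<in>S. h (g x))"
  by (induction S rule: infinite_finite_induct) (simp_all add: hom_0 hom_add)

lemma hom_power: "h (x ^ n) = h x ^ n"
  by (induction n) (simp_all add: hom_1 hom_mult)

lemma hom_prod_list: "h (prod_list xs) = prod_list (map h xs)"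
  by (induction xs) (simp_all add: hom_1 hom_mult)

lemma hom_is_inverse: "is_inverse u v \<Longrightarrow> is_inverse (h u) (h v)"
  unfolding is_inverse_def by (metis hom_mult hom_1)

lemma hom_unit_power:
  assumes "u \<in> ring_units"
  shows "h (unit_power u n) = unit_power (h u) n"
proof -
  obtain v where "is_inverse u v"
    using assms by (auto simp: ring_units_def)
  then show ?thesis
    using unit_power_eq[OF hom_is_inverse, of u v n] by (simp add: unit_power_eq hom_power)
qed

lemma hom_eval_word:
  assumes "u \<in> ring_units" "v \<in> ring_units"
  shows "h (eval_word u v w) = eval_word (h u) (h v) w"
  using assms unfolding eval_word_def hom_prod_list map_map
  by (intro arg_cong[of _ _ prod_list] map_cong refl)
    (auto simp: hom_unit_power split: gen.splits)

end


section \<open>A representation of \<open>\<F>\<close> by polynomial matrices\<close>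

definition var_mat :: "var \<Rightarrow> 'k::field poly mat2" where
  "var_mat x = (case x of Alpha \<Rightarrow> Mat2 0 0 [:0, 1:] 0 | Beta \<Rightarrow> Mat2 0 1 0 0)"

definition monomial_mat :: "monomial \<Rightarrow> 'k::field poly mat2" where
  "monomial_mat m = (case m of Monomial xs \<Rightarrow> prod_list (map var_mat xs))"

lemma monomial_mat_add: "monomial_mat (m + n) = monomial_mat m * monomial_mat n"
  by (cases m; cases n) (simp add: monomial_mat_def)

lemma monomial_mat_0: "monomial_mat 0 = 1"
  by (simp add: monomial_mat_def zero_monomial_def)

section \<open>Extension of the representation to the free algebra\<close>

definition free_mat :: "'k::field free_algebra \<Rightarrow> 'k poly mat2" where
  "free_mat p = (\<Sum>m\<in>Poly_Mapping.keys p.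
     scalar_mat2 [:Poly_Mapping.lookup p m:] * monomial_mat m)"

text \<open>Lets sums over different supports be compared over a common index set; keys outside the
  support contribute zero.\<close>

lemma free_mat_superset:
  assumes "finite S" "Poly_Mapping.keys p \<subseteq> S"
  shows "free_mat p = (\<Sum>m\<in>S. scalar_mat2 [:Poly_Mapping.lookup p m:] * monomial_mat m)"
  unfolding free_mat_def using assms
  by (intro sum.mono_neutral_left) (auto simp: in_keys_iff scalar_mat2_0)

lemma free_mat_add: "free_mat (p + q) = free_mat p + free_mat q"
proof -
  let ?S = "Poly_Mapping.keys p \<union> Poly_Mapping.keys q"
  have *: "scalar_mat2 [:a + b:] = scalar_mat2 [:a:] + scalar_mat2 [:b:]" for a b :: 'a
    by (simp add: scalar_mat2_def plus_mat2_def)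
  show ?thesis
    using keys_add[of p q]
    by (simp add: free_mat_superset[of ?S] lookup_add * distrib_right sum.distrib)
qed

lemma free_mat_single:
  "free_mat (Poly_Mapping.single m c) = scalar_mat2 [:c:] * monomial_mat m"
  by (subst free_mat_superset[of "{m}"]) (auto simp: lookup_single)

lemma free_mat_0: "free_mat 0 = 0"
  by (simp add: free_mat_def)

text \<open>Setting a coefficient at a fresh key amounts to adding a single term. This reduces
  multiplicativity of \<open>free_mat\<close> to monomials.\<close>

lemma poly_mapping_single_induct:
  assumes "P 0" "\<And>m c. P (Poly_Mapping.single m c)" "\<And>p q. P p \<Longrightarrow> P q \<Longrightarrow> P (p + q)"
  shows "P (p :: 'a \<Rightarrow>\<^sub>0 'b::monoid_add)"
proof (induction p rule: update_induct)
  case const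
  show ?case by (rule assms(1))
next
  case (update f a b)
  have "Poly_Mapping.update a b f = f + Poly_Mapping.single a b"
    using update(1)
    by (intro poly_mapping_eqI) (auto simp: lookup_update lookup_add lookup_single when_def in_keys_iff)
  then show ?case using assms(2,3) update by simp
qed

lemma free_mat_single_mult:
  "free_mat (Poly_Mapping.single m c * q) = scalar_mat2 [:c:] * monomial_mat m * free_mat q"
proof (induction q rule: poly_mapping_single_induct)
  case 1
  then show ?case by (simp add: free_mat_0)
next
  case (2 n d)
  have "scalar_mat2 [:c * d:] = scalar_mat2 [:c:] * scalar_mat2 [:d:]"
    by (simp add: scalar_mat2_def times_mat2_def)
  then have "free_mat (Poly_Mapping.single m c * Poly_Mapping.single n d) =
      scalar_mat2 [:c:] * (scalar_mat2 [:d:] * monomial_mat m) * monomial_mat n"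
    by (simp add: mult_single free_mat_single monomial_mat_add mult.assoc)
  \<comment> \<open>Scalar matrices are central, so the coefficient \<open>d\<close> moves past the
    matrix of \<open>m\<close>.\<close>
  then show ?case
    by (simp only: scalar_mat2_commute[of "[:d:]" "monomial_mat m"] free_mat_single mult.assoc)
next
  case (3 p q)
  then show ?case by (simp add: distrib_left free_mat_add)
qed

lemma free_mat_mult: "free_mat (p * q) = free_mat p * free_mat q"
proof (induction p rule: poly_mapping_single_induct)
  case 1
  then show ?case by (simp add: free_mat_0)
next
  case (2 m c)
  then show ?case by (simp add: free_mat_single free_mat_single_mult)
next
  case (3 p q)
  then show ?case by (simp add: distrib_right free_mat_add)
qed

lemma free_mat_1: "free_mat 1 = 1"
  using free_mat_single[of 0 "1 :: 'a"]
  by (simp add: monomial_mat_0 scalar_mat2_1 single_one flip: one_pCons)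

lemma free_mat_free_var: "free_mat (free_var x) = var_mat x"
  by (simp add: free_var_def free_mat_single monomial_mat_def scalar_mat2_1 flip: one_pCons)

lemma free_mat_diff: "free_mat (p - q) = free_mat p - free_mat q"
  using free_mat_add[of "p - q" q] by (simp add: algebra_simps)

text \<open>The kernel of \<open>free_mat\<close> is a two-sided ideal, and it contains both
  generators because \<open>s E21\<close> and \<open>E12\<close> square to zero.\<close>

lemma free_mat_square_ideal:
  assumes "p \<in> square_ideal"
  shows "free_mat p = 0"
proof -
  have "square_ideal \<subseteq> {p. free_mat p = 0}"
    unfolding square_ideal_def
    by (rule hull_minimal)
      (auto simp: two_sided_ideal_def free_mat_0 free_mat_add free_mat_mult free_mat_free_var
        power2_eq_square var_mat_def times_mat2_def, simp_all add: zero_mat2_def)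
  then show ?thesis using assms by blast
qed

section \<open>Passage of the representation to the quotient algebra\<close>

lift_definition falg_mat :: "'k::field falg \<Rightarrow> 'k poly mat2" is free_mat
  unfolding square_rel_def
  by (metis free_mat_square_ideal free_mat_diff eq_iff_diff_eq_0)

interpretation falg_mat: ring_1_hom falg_mat
proof
  show "falg_mat (x + y) = falg_mat x + falg_mat y" for x y :: "'a falg"
    by transfer (rule free_mat_add)
  show "falg_mat (x * y) = falg_mat x * falg_mat y" for x y :: "'a falg"
    by transfer (rule free_mat_mult)
  show "falg_mat 1 = (1 :: 'a poly mat2)"
    by transfer (rule free_mat_1)
qed

lemma falg_mat_const: "falg_mat (falg_const c) = scalar_mat2 [:c:]"
  by transfer (simp add: free_mat_single monomial_mat_0)

lift_definition falg_var :: "var \<Rightarrow> 'k::field falg" is free_var .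

lemma falg_var_square: "falg_var x * falg_var x = 0"
proof transfer
  fix x
  have "{free_var Alpha ^ 2, free_var Beta ^ 2} \<subseteq> (square_ideal :: 'a free_algebra set)"
    unfolding square_ideal_def by (rule hull_subset)
  then show "square_rel (free_var x * free_var x) (0 :: 'a free_algebra)"
    by (cases x) (simp_all add: square_rel_def power2_eq_square)
qed

lemma falg_mat_var: "falg_mat (falg_var x) = var_mat x"
  by transfer (rule free_mat_free_var)


section \<open>Leading coefficients of words\<close>

text \<open>The images of the units u and v, multiplied out; the second is the conjugate of the
  first by \<open>1 + E12\<close>.\<close>

definition gen_mat :: "gen \<Rightarrow> 'k::field poly mat2" where
  "gen_mat g = (case g of
     GenX \<Rightarrow> Mat2 [:1, 0, 1:] [:0, 1:] [:0, 1:] 1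
   | GenY \<Rightarrow> Mat2 [:1, - 1, 1:] [:0, 0, 1:] [:0, 1:] [:1, 1:])"

definition gen_mat_inv :: "gen \<Rightarrow> 'k::field poly mat2" where
  "gen_mat_inv g = (case g of
     GenX \<Rightarrow> Mat2 1 [:0, - 1:] [:0, - 1:] [:1, 0, 1:]
   | GenY \<Rightarrow> Mat2 [:1, 1:] [:0, 0, - 1:] [:0, - 1:] [:1, - 1, 1:])"

text \<open>Both matrices have determinant 1, and \<open>gen_mat_inv\<close> is the
  adjugate.\<close>

lemma is_inverse_gen_mat: "is_inverse (gen_mat g) (gen_mat_inv g)"
  by (cases g) (simp_all add: is_inverse_def gen_mat_def gen_mat_inv_def mat2_defs one_pCons del: one_poly_eq_simps)

text \<open>The column of the rank one leading coefficient of a syllable; \<open>end_vec\<close>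
  gives the row. Only the generator and the sign of the exponent enter, since the leading
  coefficient of a single letter is idempotent.\<close>

definition begin_vec :: "gen \<times> int \<Rightarrow> 'k::field \<times> 'k" where
  "begin_vec s = (if snd s > 0 then (1, 0) else if fst s = GenX then (0, 1) else (- 1, 1))"

definition end_vec :: "gen \<times> int \<Rightarrow> 'k::field \<times> 'k" where
  "end_vec s = (if snd s < 0 then (0, 1) else if fst s = GenX then (1, 0) else (1, 1))"

text \<open>
  The leading coefficients of \<open>Y\<^sup>-\<^sup>1X\<close> and \<open>X\<^sup>-\<^sup>1Y\<close> at the degree to which they drop are the outer
  products of these vectors with the end vectors of \<open>X\<close> and \<open>Y\<close>.
\<close>

definition drop_vec :: "gen \<Rightarrow> 'k::field \<times> 'k" where
  "drop_vec g = (case g of GenX \<Rightarrow> (1, - 1) | GenY \<Rightarrow> (0, 1))"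

section \<open>Leading terms of a single syllable and of a junction with a drop\<close>

lemma leads_gen_mat_power:
  assumes "n \<noteq> 0"
  shows "leads (nat (2 * \<bar>n\<bar>)) (outer (begin_vec (g, n)) (end_vec (g, n)))
    (unit_power (gen_mat g :: 'k::field poly mat2) n)"
proof -
  have nat: "nat (2 * \<bar>n\<bar>) = 2 * nat \<bar>n\<bar>" by simp
  \<comment> \<open>Row times column of one and the same syllable is 1, for either generator and
    either sign.\<close>
  have idem: "outer (begin_vec (g, n)) (end_vec (g, n)) * outer (begin_vec (g, n)) (end_vec (g, n))
      = (outer (begin_vec (g, n)) (end_vec (g, n)) :: 'k mat2)"
    using assms by (cases g) (auto simp: outer_def begin_vec_def end_vec_def times_mat2_def)
  show ?thesis
  proof (cases "n > 0")
    case True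
    have "leads 2 (outer (begin_vec (g, n)) (end_vec (g, n))) (gen_mat g :: 'k poly mat2)"
      using True by (cases g) (auto simp: leads_def coeff_mat2_def gen_mat_def outer_def
          begin_vec_def end_vec_def numeral_2_eq_2 coeff_pCons split: nat.splits)
    from leads_power[OF this idem, of "nat \<bar>n\<bar>"] show ?thesis
      using True unfolding nat by (simp add: unit_power_eq[OF is_inverse_gen_mat])
  next
    case False
    have "leads 2 (outer (begin_vec (g, n)) (end_vec (g, n))) (gen_mat_inv g :: 'k poly mat2)"
      using False assms by (cases g) (auto simp: leads_def coeff_mat2_def gen_mat_inv_def outer_def
          begin_vec_def end_vec_def numeral_2_eq_2 coeff_pCons split: nat.splits)
    from leads_power[OF this idem, of "nat \<bar>n\<bar>"] show ?thesis
      using False assms unfolding nat by (simp add: unit_power_eq[OF is_inverse_gen_mat])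
  qed
qed

text \<open>An inverse letter of the other generator is absorbed without raising the degree: the
  cancellation already happens against the first letter of the power.\<close>

lemma leads_drop_power:
  assumes "n > 0" "g \<noteq> h"
  shows "leads (nat (2 * n)) (outer (drop_vec g) (end_vec (g, n)))
    (gen_mat_inv h * unit_power (gen_mat g :: 'k::field poly mat2) n)"
proof -
  \<comment> \<open>Direct computation: in the product of the two letters all terms of degree above
    2 vanish or cancel.\<close>
  have base: "leads 2 (outer (drop_vec g) (end_vec (g, n))) (gen_mat_inv h * gen_mat g :: 'k poly mat2)"
    using assms by (cases g; cases h) (auto simp: leads_def coeff_mat2_def gen_mat_def gen_mat_inv_def
        outer_def drop_vec_def end_vec_def times_mat2_def numeral_2_eq_2 one_pCons coeff_pCons
        split: nat.splits simp del: one_poly_eq_simps)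
  have unfold: "unit_power (gen_mat g :: 'k poly mat2) n = gen_mat g * unit_power (gen_mat g) (n - 1)"
    using assms(1) by (simp add: unit_power_eq[OF is_inverse_gen_mat] nat_diff_distrib
        flip: power_Suc)
  show ?thesis
  proof (cases "n = 1")
    case True
    then show ?thesis using base by (simp add: unit_power_eq[OF is_inverse_gen_mat])
  next
    case False
    then have nz: "n - 1 \<noteq> 0" by simp
    \<comment> \<open>The row of \<open>g\<close> against its own column gives 1, so the further
      \<open>n - 1\<close> letters keep the leading coefficient.\<close>
    have "outer (drop_vec g) (end_vec (g, n)) * outer (begin_vec (g, n - 1)) (end_vec (g, n - 1))
        = (outer (drop_vec g) (end_vec (g, n)) :: 'k mat2)"
      using assms False
      by (cases g) (simp_all add: outer_def drop_vec_def begin_vec_def end_vec_def times_mat2_def)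
    moreover have "2 + nat (2 * \<bar>n - 1\<bar>) = nat (2 * n)"
    proof -
      have "2 * n = 2 + 2 * \<bar>n - 1\<bar>" using assms(1) by simp
      moreover have "nat (2 + 2 * \<bar>n - 1\<bar>) = 2 + nat (2 * \<bar>n - 1\<bar>)"
        by (subst nat_add_distrib) simp_all
      ultimately show ?thesis by (simp only:)
    qed
    ultimately show ?thesis
      using leads_mult[OF base leads_gen_mat_power[OF nz, of g]]
      by (simp only: unfold mult.assoc)
  qed
qed

text \<open>The last inverse letter of the syllable is handed over to \<open>M\<close>, and the
  other \<open>- n - 1\<close> letters multiply as an ordinary power. Up to sign
  \<open>drop_vec h\<close> is \<open>begin_vec (g, n)\<close>; the sign is negative exactly for
  \<open>g = GenY\<close>, which yields the sign of a junction from a negative power of Y to a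
  positive power of X.\<close>

lemma leads_cons_drop:
  assumes "n < 0" "g \<noteq> h"
    and lead: "leads N (scalar_mat2 c * outer (drop_vec h) r) (gen_mat_inv g * M :: 'k::field poly mat2)"
  shows "leads (nat (2 * (- n - 1)) + N)
    (scalar_mat2 (if g = GenY then - c else c) * outer (begin_vec (g, n)) r)
    (unit_power (gen_mat g) n * M)"
proof -
  have unfold: "unit_power (gen_mat g :: 'k poly mat2) n =
      unit_power (gen_mat g) (n + 1) * gen_mat_inv g"
  proof (cases "n = - 1")
    case False
    moreover have "nat (- n) = Suc (nat (- (n + 1)))" using assms(1) by simp
    ultimately show ?thesis
      using assms(1) by (simp only: unit_power_eq[OF is_inverse_gen_mat] power_Suc2 split: if_split) auto
  qed (simp add: unit_power_eq[OF is_inverse_gen_mat])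
  show ?thesis
  proof (cases "n = - 1")
    case True
    \<comment> \<open>No letter is left over, so the two columns are compared directly:
      \<open>(1, - 1)\<close> is the negative of \<open>(- 1, 1)\<close>.\<close>
    have "scalar_mat2 (if g = GenY then - c else c) * outer (begin_vec (g, n)) r =
        scalar_mat2 c * outer (drop_vec h) r"
      using assms(2) True
      by (cases g; cases h)
        (simp_all add: outer_def drop_vec_def begin_vec_def scalar_mat2_def mat2_defs)
    then show ?thesis
      using lead True by (simp add: unit_power_eq[OF is_inverse_gen_mat])
  next
    case False
    \<comment> \<open>Here the sign arises as the product of the row \<open>(0, 1)\<close> with
      \<open>drop_vec h\<close>.\<close>
    have "outer (begin_vec (g, n + 1)) (end_vec (g, n + 1)) * (scalar_mat2 c * outer (drop_vec h) r) =
        scalar_mat2 (if g = GenY then - c else c) * outer (begin_vec (g, n)) r"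
      using assms(1,2) False
      by (cases g; cases h)
        (simp_all add: outer_def drop_vec_def begin_vec_def end_vec_def scalar_mat2_def mat2_defs)
    moreover have "\<bar>n + 1\<bar> = - n - 1" using assms by simp
    ultimately show ?thesis
      using leads_mult[OF leads_gen_mat_power[of "n + 1" g] lead] False
      by (simp add: unfold mult.assoc)
  qed
qed

section \<open>Leading terms of whole words\<close>

definition list_eval :: "(gen \<times> int) list \<Rightarrow> 'k::field poly mat2" where
  "list_eval ws = prod_list (map (\<lambda>(g, n). unit_power (gen_mat g) n) ws)"

text \<open>Sign and cumulus are restated on raw syllable lists, so that an induction can strip the
  first syllable.\<close>

definition list_sgn :: "(gen \<times> int) list \<Rightarrow> 'k::ring_1" where
  "list_sgn ws = (- 1) ^ length (filter
    (\<lambda>((g, a), (h, b)). (g = GenX \<and> a > 0 \<and> h = GenY \<and> b < 0) \<or>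
                        (g = GenY \<and> a < 0 \<and> h = GenX \<and> b > 0)) (zip ws (tl ws)))"

definition list_cumulus :: "(gen \<times> int) list \<Rightarrow> int" where
  "list_cumulus ws = (\<Sum>s\<leftarrow>ws. \<bar>snd s\<bar>) - int (length (filter
    (\<lambda>((g, a), (h, b)). (g = GenX \<and> a < 0 \<and> h = GenY \<and> b > 0) \<or>
                        (g = GenY \<and> a < 0 \<and> h = GenX \<and> b > 0)) (zip ws (tl ws))))"

lemma list_sgn_single: "list_sgn [s] = 1"
  by (simp add: list_sgn_def)

lemma list_sgn_Cons_Cons:
  "g \<noteq> h \<Longrightarrow> list_sgn ((g, a) # (h, b) # ws) =
    (if g = GenX \<and> a > 0 \<and> b < 0 \<or> g = GenY \<and> a < 0 \<and> b > 0 then - 1 else 1) * list_sgn ((h, b) # ws)"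
  by (cases g; cases h) (simp_all add: list_sgn_def)

lemma list_cumulus_single: "list_cumulus [(g, a)] = \<bar>a\<bar>"
  by (simp add: list_cumulus_def)

text \<open>As the generators differ, the test for a drop reduces to the two signs.\<close>

lemma list_cumulus_Cons_Cons:
  "g \<noteq> h \<Longrightarrow> list_cumulus ((g, a) # (h, b) # ws) =
    \<bar>a\<bar> - (if a < 0 \<and> b > 0 then 1 else 0) + list_cumulus ((h, b) # ws)"
  by (cases g; cases h) (simp_all add: list_cumulus_def)

text \<open>Each drop is charged to the syllable before it, whose exponent has absolute value at
  least 1; the last syllable is never charged.\<close>

lemma list_cumulus_pos: "reduced ws \<Longrightarrow> ws \<noteq> [] \<Longrightarrow> list_cumulus ws > 0"
proof (induction ws rule: induct_list012)
  case (2 s)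
  then show ?case by (cases s) (simp add: list_cumulus_single reduced_Cons)
next
  case (3 s t ws)
  obtain g a h b where "s = (g, a)" "t = (h, b)" by (cases s; cases t)
  then show ?case
    using 3 by (auto simp: list_cumulus_Cons_Cons reduced_Cons)
qed simp

text \<open>The second claim strengthens the induction: a preceding syllable with negative exponent
  passes its last letter to a word starting with a positive exponent, and the leading term of that
  product must be known as well.\<close>

lemma leads_word:
  assumes "reduced (s # ws)"
  shows "leads (nat (2 * list_cumulus (s # ws)))
      (scalar_mat2 (list_sgn (s # ws)) * outer (begin_vec s) (end_vec (last (s # ws))))
      (list_eval (s # ws) :: 'k::field poly mat2) \<and>
    (\<forall>h. snd s > 0 \<and> fst s \<noteq> h \<longrightarrow> leads (nat (2 * list_cumulus (s # ws)))
      (scalar_mat2 (list_sgn (s # ws)) * outer (drop_vec (fst s)) (end_vec (last (s # ws))))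
      (gen_mat_inv h * list_eval (s # ws) :: 'k poly mat2))"
  using assms
proof (induction ws arbitrary: s)
  case Nil
  then show ?case
    using leads_gen_mat_power[of "snd s" "fst s", where 'k = 'k]
      leads_drop_power[of "snd s" "fst s", where 'k = 'k]
    by (cases s) (auto simp: list_eval_def list_sgn_single list_cumulus_single scalar_mat2_1 reduced_Cons)
next
  case (Cons t ws)
  obtain g a where s: "s = (g, a)" by (cases s)
  obtain h b where t: "t = (h, b)" by (cases t)
  have red: "reduced (t # ws)" and a: "a \<noteq> 0" and b: "b \<noteq> 0" and gh: "g \<noteq> h"
    using Cons.prems by (auto simp: reduced_Cons s t)
  have cum: "list_cumulus (t # ws) > 0"
    using list_cumulus_pos[OF red] by simp
  let ?r = "end_vec (last (t # ws)) :: 'k \<times> 'k"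
  note IH = Cons.IH[OF red]
  have eval: "list_eval (s # t # ws) = (unit_power (gen_mat g) a * list_eval (t # ws) :: 'k poly mat2)"
    by (simp add: list_eval_def s)
  show ?case
  proof (cases "a < 0 \<and> b > 0")
    \<comment> \<open>The row of the first syllable annihilates the column of the second, so one
      inverse letter is moved across the junction. The second claim is vacuous, as \<open>a\<close>
      is negative.\<close>
    case True
    have "nat (2 * (- a - 1)) + nat (2 * list_cumulus (t # ws)) = nat (2 * list_cumulus (s # t # ws))"
      using True gh cum by (simp add: s t list_cumulus_Cons_Cons flip: nat_add_distrib)
    moreover have "list_sgn (s # t # ws) = (if g = GenY then - list_sgn (t # ws) else list_sgn (t # ws) :: 'k)"
      using True gh by (simp add: s t list_sgn_Cons_Cons)
    moreover have "leads (nat (2 * list_cumulus (t # ws)))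
        (scalar_mat2 (list_sgn (t # ws)) * outer (drop_vec h) ?r)
        (gen_mat_inv g * list_eval (t # ws) :: 'k poly mat2)"
      using IH True gh by (auto simp: t)
    note leads_cons_drop[OF conjunct1[OF True] gh this]
    ultimately have "leads (nat (2 * list_cumulus (s # t # ws)))
        (scalar_mat2 (list_sgn (s # t # ws)) * outer (begin_vec s) ?r)
        (list_eval (s # t # ws) :: 'k poly mat2)"
      unfolding eval by (simp only: s)
    then show ?thesis
      using True by (simp add: s)
  next
    case False
    have N: "nat (2 * \<bar>a\<bar>) + nat (2 * list_cumulus (t # ws)) = nat (2 * list_cumulus (s # t # ws))"
      using False gh cum by (auto simp: s t list_cumulus_Cons_Cons simp flip: nat_add_distrib)
    \<comment> \<open>The column \<open>x\<close> stays arbitrary, to serve for both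
      \<open>begin_vec s\<close> and \<open>drop_vec (fst s)\<close>.\<close>
    have A: "outer x (end_vec (g, a)) * (scalar_mat2 (list_sgn (t # ws)) * outer (begin_vec t) ?r) =
        scalar_mat2 (list_sgn (s # t # ws)) * outer x ?r" for x :: "'k \<times> 'k"
    proof -
      \<comment> \<open>Without a drop the product is 1, except for a positive power of X followed
        by a negative power of Y, where it is -1.\<close>
      have "dot (end_vec (g, a)) (begin_vec t) * list_sgn (t # ws) = (list_sgn (s # t # ws) :: 'k)"
        using False gh a b
        by (cases g; cases h) (auto simp: s t list_sgn_Cons_Cons dot_def end_vec_def begin_vec_def)
      then show ?thesis
        by (simp add: outer_mult_scalar_outer)
    qed
    have "leads (nat (2 * list_cumulus (s # t # ws)))
      (scalar_mat2 (list_sgn (s # t # ws)) * outer (begin_vec s) ?r)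
      (list_eval (s # t # ws) :: 'k poly mat2)"
      using leads_mult[OF leads_gen_mat_power[OF a, of g] conjunct1[OF IH]]
      unfolding N A eval by (simp only: s)
    moreover have "leads (nat (2 * list_cumulus (s # t # ws)))
      (scalar_mat2 (list_sgn (s # t # ws)) * outer (drop_vec (fst s)) ?r)
      (gen_mat_inv k * list_eval (s # t # ws) :: 'k poly mat2)" if "snd s > 0" "fst s \<noteq> k" for k
    proof -
      have "a > 0" "g \<noteq> k" "a = \<bar>a\<bar>" using that s by auto
      then show ?thesis
        using leads_mult[OF leads_drop_power[of a g k] conjunct1[OF IH]]
        unfolding A eval using N by (simp add: s mult.assoc)
    qed
    ultimately show ?thesis by simp
  qed
qed

lemma list_eval_0: "list_eval [] = 1"
  by (simp add: list_eval_def)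


section \<open>Laurent identities\<close>

text \<open>The zero vector is a default value for the unit word, which has cumulus 0.\<close>

definition begin_word :: "fgroup \<Rightarrow> 'k::field \<times> 'k" where
  "begin_word w = (case syllables w of [] \<Rightarrow> (0, 0) | s # _ \<Rightarrow> begin_vec s)"

definition end_word :: "fgroup \<Rightarrow> 'k::field \<times> 'k" where
  "end_word w = (case syllables w of [] \<Rightarrow> (0, 0) | s # ws \<Rightarrow> end_vec (last (s # ws)))"

lemma syllables_eq_Nil: "syllables w = [] \<longleftrightarrow> w = 0"
  by transfer simp

lemma word_sgn_eq: "word_sgn w = list_sgn (syllables w)"
  by (simp add: word_sgn_def list_sgn_def syllable_pairs_def)

lemma cumulus_eq: "cumulus w = list_cumulus (syllables w)"
  by (simp add: cumulus_def list_cumulus_def syllable_pairs_def)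

lemma cumulus_0: "cumulus 0 = 0"
  by (simp add: cumulus_eq list_cumulus_def zero_fgroup.rep_eq)

lemma cumulus_pos: "w \<noteq> 0 \<Longrightarrow> cumulus w > 0"
  using syllables[of w] by (simp add: cumulus_eq list_cumulus_pos syllables_eq_Nil)

text \<open>Words of smaller cumulus have degree below \<open>2 * N\<close>. Positivity of
  \<open>N\<close> puts the unit word, evaluated to the identity matrix, among them.\<close>

lemma coeff_eval_word:
  assumes "cumulus w \<le> N" "N > 0"
  shows "coeff_mat2 (eval_word (gen_mat GenX) (gen_mat GenY) w) (nat (2 * N)) =
    (if cumulus w = N then scalar_mat2 (word_sgn w) * outer (begin_word w) (end_word w)
     else (0 :: 'k::field mat2))"
proof -
  have eval: "eval_word (gen_mat GenX) (gen_mat GenY) w = (list_eval (syllables w) :: 'k poly mat2)"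
    unfolding eval_word_def list_eval_def
    by (intro arg_cong[of _ _ prod_list] map_cong refl) (auto split: gen.splits)
  show ?thesis
  proof (cases "syllables w")
    case Nil
    then show ?thesis
      using assms leads_coeff_above[OF leads_1, of "nat (2 * N)", where 'a = 'k]
      by (simp add: eval cumulus_eq list_eval_0) (simp add: list_cumulus_def)
  next
    case (Cons s ws)
    have red: "reduced (s # ws)" using syllables[of w] Cons by simp
    have lead: "leads (nat (2 * cumulus w)) (scalar_mat2 (word_sgn w) * outer (begin_word w) (end_word w))
        (list_eval (syllables w) :: 'k poly mat2)"
      using leads_word[OF red, where 'k = 'k]
      by (simp add: cumulus_eq word_sgn_eq Cons begin_word_def end_word_def)
    show ?thesis
    proof (cases "cumulus w = N")
      case True
      then show ?thesis using lead by (simp add: leads_def eval)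
    next
      case False
      then show ?thesis
        using assms leads_coeff_above[OF lead, of "nat (2 * N)"] by (simp add: eval)
    qed
  qed
qed

section \<open>The two units and the top coefficient of an identity\<close>

lemma gen_mat_units:
  obtains u v :: "'k::field falg"
  where "u \<in> ring_units" "v \<in> ring_units" "falg_mat u = gen_mat GenX" "falg_mat v = gen_mat GenY"
proof -
  define a b :: "'k falg" where "a = falg_var Alpha" and "b = falg_var Beta"
  have sq: "a * a = 0" "b * b = 0" by (simp_all add: a_def b_def falg_var_square)
  \<comment> \<open>Two copies of \<open>b\<close> meet in the middle.\<close>
  have "b * a * b * (b * a * b) = b * a * (b * b) * a * b" by (simp only: mult.assoc)
  then have bab: "(b * a * b) * (b * a * b) = 0" using sq by simp
  \<comment> \<open>Since \<open>b * a * b\<close> maps to \<open>s E12\<close> and \<open>a\<close>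
    to \<open>s E21\<close>, the image is a product of an upper and a lower unitriangular
    matrix.\<close>
  define u where "u = (1 + b * a * b) * (1 + a)"
  define v where "v = (1 - b) * u * (1 + b)"
  have inv_b: "is_inverse (1 + b) (1 - b)"
    by (rule is_inverse_1_plus_square_zero) (rule sq)
  have inv_u: "is_inverse u ((1 - a) * (1 - b * a * b))"
    unfolding u_def by (intro is_inverse_mult is_inverse_1_plus_square_zero bab sq)
  have inv_v: "is_inverse v ((1 - b) * (((1 - a) * (1 - b * a * b)) * (1 + b)))"
    unfolding v_def by (intro is_inverse_mult inv_u inv_b is_inverse_sym[OF inv_b])
  have hom_b: "falg_mat b = Mat2 0 1 0 0" and hom_a: "falg_mat a = Mat2 0 0 [:0, 1:] 0"
    by (simp_all add: a_def b_def falg_mat_var var_mat_def)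
  have hom_u: "falg_mat u = gen_mat GenX"
    by (simp add: u_def falg_mat.hom_add falg_mat.hom_mult falg_mat.hom_1 hom_a hom_b gen_mat_def
        mat2_defs) (simp add: one_pCons del: one_poly_eq_simps)
  have "falg_mat v = gen_mat GenY"
    by (simp add: v_def falg_mat.hom_add falg_mat.hom_diff falg_mat.hom_mult falg_mat.hom_1 hom_u hom_b
        gen_mat_def mat2_defs) (simp add: one_pCons del: one_poly_eq_simps)
  then show ?thesis
    using that[of u v] inv_u inv_v hom_u by (auto simp: ring_units_def)
qed

lemma laurent_identity_coeff:
  fixes f :: "'k::field laurent"
  assumes "laurent_identity f" "laurent_cumulus f > 0"
  shows "(\<Sum>w\<in>Poly_Mapping.keys f. if cumulus w = laurent_cumulus f
    then scalar_mat2 (word_sgn w * Poly_Mapping.lookup f w) * outer (begin_word w) (end_word w)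
    else 0) = 0"
proof -
  obtain u v :: "'k falg" where uv: "u \<in> ring_units" "v \<in> ring_units"
    and hom: "falg_mat u = gen_mat GenX" "falg_mat v = gen_mat GenY"
    by (rule gen_mat_units)
  let ?N = "laurent_cumulus f"
  have "0 = falg_mat (eval_laurent u v f)"
    using assms(1) uv by (simp add: laurent_identity_def falg_mat.hom_0)
  also have "\<dots> = (\<Sum>w\<in>Poly_Mapping.keys f. scalar_mat2 [:Poly_Mapping.lookup f w:] *
      eval_word (gen_mat GenX) (gen_mat GenY) w)"
    by (simp add: eval_laurent_def falg_mat.hom_sum falg_mat.hom_mult falg_mat.hom_eval_word[OF uv]
        hom falg_mat_const)
  \<comment> \<open>Passage to the coefficient at \<open>s^(2N)\<close>, the highest degree that
    words of the support can reach.\<close>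
  finally have "0 = coeff_mat2 \<dots> (nat (2 * ?N))"
    by (metis coeff_mat2_0)
  also have "\<dots> = (\<Sum>w\<in>Poly_Mapping.keys f. scalar_mat2 (Poly_Mapping.lookup f w) *
      coeff_mat2 (eval_word (gen_mat GenX) (gen_mat GenY) w) (nat (2 * ?N)))"
    by (simp add: coeff_mat2_sum coeff_mat2_scalar)
  also have "\<dots> = (\<Sum>w\<in>Poly_Mapping.keys f. if cumulus w = ?N
    then scalar_mat2 (word_sgn w * Poly_Mapping.lookup f w) * outer (begin_word w) (end_word w)
    else 0)"
  proof (rule sum.cong[OF refl])
    fix w assume "w \<in> Poly_Mapping.keys f"
    then have "cumulus w \<le> ?N"
      unfolding laurent_cumulus_def by (intro Max_ge) auto
    then show "scalar_mat2 (Poly_Mapping.lookup f w) *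
        coeff_mat2 (eval_word (gen_mat GenX) (gen_mat GenY) w) (nat (2 * ?N)) =
      (if cumulus w = ?N
       then scalar_mat2 (word_sgn w * Poly_Mapping.lookup f w) * outer (begin_word w) (end_word w)
       else 0)"
      using assms(2)
      by (simp add: coeff_eval_word mult.commute[of "word_sgn w"] scalar_mat2_mult mult.assoc)
  qed
  finally show ?thesis by simp
qed

section \<open>Sorting words by beginning and end\<close>

lemma syl_eq_iff: "syl g n = syl h m \<longleftrightarrow> n = 0 \<and> m = 0 \<or> g = h \<and> n = m"
  by transfer auto

lemma syl_eq_0_iff: "0 = syl g n \<longleftrightarrow> n = 0"
  by transfer auto

text \<open>Words of other types are kept as zero terms, so that all corners are sums over one index
  set and combine termwise.\<close>

lemma corner_eq:
  "corner f b e = (\<Sum>w\<in>Poly_Mapping.keys f. if cumulus w = laurent_cumulus f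
    then (if beginning w = b \<and> ending w = e then word_sgn w * Poly_Mapping.lookup f w else 0) else 0)"
  unfolding corner_def by (rule sum.mono_neutral_cong_left) auto

text \<open>The vectors see only the signs of the first and last exponents, so every word other than
  the unit has one of sixteen types.\<close>

lemma beginning_ending_cases:
  assumes "w \<noteq> 0"
  obtains g n h m where "n = 1 \<or> n = - 1" "m = 1 \<or> m = - 1"
    "beginning w = syl g n" "ending w = syl h m"
    "begin_word w = (begin_vec (g, n) :: 'k::field \<times> 'k)" "end_word w = (end_vec (h, m) :: 'k \<times> 'k)"
proof -
  obtain s ws where w: "syllables w = s # ws"
    using assms by (cases "syllables w") (auto simp: syllables_eq_Nil)
  let ?l = "last (s # ws)"
  have "\<forall>t\<in>set (s # ws). snd t \<noteq> 0"
    using syllables[of w] w by (simp add: reduced_def)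
  then have nz: "snd s \<noteq> 0" "snd ?l \<noteq> 0"
    using last_in_set[of "s # ws"] by (auto simp del: last.simps)
  have "ending w = syl (fst ?l) (sgn (snd ?l))"
    by (cases ws rule: rev_cases) (simp_all add: ending_def w)
  moreover have "beginning w = syl (fst s) (sgn (snd s))"
    by (simp add: beginning_def w)
  moreover have "begin_word w = (begin_vec (fst s, sgn (snd s)) :: 'k \<times> 'k)"
    by (simp add: begin_word_def begin_vec_def w)
  moreover have "end_word w = (end_vec (fst ?l, sgn (snd ?l)) :: 'k \<times> 'k)"
    unfolding end_word_def w by (simp add: end_vec_def del: last.simps)
  moreover have "sgn (snd s) = 1 \<or> sgn (snd s) = - 1" "sgn (snd ?l) = 1 \<or> sgn (snd ?l) = - 1"
    using nz by (simp_all add: sgn_if del: last.simps)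
  ultimately show ?thesis
    using that by blast
qed

lemma mat2_sum:
  "m11 (sum F S) = (\<Sum>x\<in>S. m11 (F x))" "m12 (sum F S) = (\<Sum>x\<in>S. m12 (F x))"
  "m21 (sum F S) = (\<Sum>x\<in>S. m21 (F x))" "m22 (sum F S) = (\<Sum>x\<in>S. m22 (F x))"
  by (induction S rule: infinite_finite_induct) (simp_all add: zero_mat2_def plus_mat2_def)

theorem proposition4p2:
  fixes f :: "'k::field laurent"
  assumes "f \<noteq> 0" and "laurent_identity f"
  shows "f1 f = 0 \<and> f2 f = 0 \<and> f3 f = 0 \<and> f4 f = 0"
proof (cases "laurent_cumulus f > 0")
  case True
  let ?N = "laurent_cumulus f"
  define A :: "fgroup \<Rightarrow> 'k mat2" where "A w = (if cumulus w = ?N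
    then scalar_mat2 (word_sgn w * Poly_Mapping.lookup f w) * outer (begin_word w) (end_word w)
    else 0)" for w
  define t :: "fgroup \<Rightarrow> fgroup \<Rightarrow> fgroup \<Rightarrow> 'k" where "t w b e = (if cumulus w = ?N
    then (if beginning w = b \<and> ending w = e then word_sgn w * Poly_Mapping.lookup f w else 0) else 0)"
    for w b e
  have t: "corner f b e = (\<Sum>w\<in>Poly_Mapping.keys f. t w b e)" for b e
    by (simp add: corner_eq t_def)
  \<comment> \<open>The signs in f_1 to f_4 are products of an entry of \<open>begin_vec\<close>
    with an entry of \<open>end_vec\<close>, so the comparison is made one word at a time.\<close>
  have "m11 (A w) = t w gX gX + t w gX gY + t w gY gX + t w gY gY - t w (- gY) gX - t w (- gY) gY \<and>
    m12 (A w) = t w gX (- gX) + t w gX gY + t w gX (- gY) + t w gY (- gX) + t w gY gY + t w gY (- gY)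
      - t w (- gY) (- gX) - t w (- gY) gY - t w (- gY) (- gY) \<and>
    m21 (A w) = t w (- gX) gX + t w (- gX) gY + t w (- gY) gX + t w (- gY) gY \<and>
    m22 (A w) = t w (- gX) (- gX) + t w (- gX) gY + t w (- gX) (- gY)
      + t w (- gY) (- gX) + t w (- gY) gY + t w (- gY) (- gY)" for w
  proof (cases "cumulus w = ?N")
    case cum: True
    then have "w \<noteq> 0" using True cumulus_0 by auto
    then obtain g n h m where nm: "n = 1 \<or> n = - 1" "m = 1 \<or> m = - 1"
      and w: "beginning w = syl g n" "ending w = syl h m"
        "begin_word w = (begin_vec (g, n) :: 'k \<times> 'k)" "end_word w = (end_vec (h, m) :: 'k \<times> 'k)"
      by (rule beginning_ending_cases)
    define c :: 'k where "c = word_sgn w * Poly_Mapping.lookup f w"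
    have "t w (syl g' n') (syl h' m') = (if g' = g \<and> n' = n \<and> h' = h \<and> m' = m then c else 0)"
      for g' n' h' m'
      using nm cum by (auto simp: t_def c_def w syl_eq_iff)
    moreover have "A w = Mat2 (c * fst (begin_vec (g, n)) * fst (end_vec (h, m)))
        (c * fst (begin_vec (g, n)) * snd (end_vec (h, m)))
        (c * snd (begin_vec (g, n)) * fst (end_vec (h, m)))
        (c * snd (begin_vec (g, n)) * snd (end_vec (h, m)))"
      using cum by (simp add: A_def c_def w scalar_mat2_def outer_def times_mat2_def mult.assoc)
    ultimately show ?thesis
      using nm by (cases g; cases h) (auto simp: begin_vec_def end_vec_def uminus_syl)
  qed (simp add: A_def t_def zero_mat2_def)
  then have "f1 f = m11 (\<Sum>w\<in>Poly_Mapping.keys f. A w) \<and> f2 f = m12 (\<Sum>w\<in>Poly_Mapping.keys f. A w) \<and>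
    f3 f = m21 (\<Sum>w\<in>Poly_Mapping.keys f. A w) \<and> f4 f = m22 (\<Sum>w\<in>Poly_Mapping.keys f. A w)"
    by (simp add: f1_def f2_def f3_def f4_def t mat2_sum sum.distrib sum_subtractf)
  moreover have "(\<Sum>w\<in>Poly_Mapping.keys f. A w) = 0"
    using laurent_identity_coeff[OF assms(2) True] by (simp add: A_def)
  ultimately show ?thesis by (simp add: zero_mat2_def)
next
  case False
  have "corner f b e = 0" if "b \<noteq> 0" for b e
  proof -
    \<comment> \<open>A word of nonpositive cumulus is the unit, and so is its beginning, which
      therefore differs from \<open>b\<close>. All corners are empty sums.\<close>
    have "beginning w \<noteq> b" if "cumulus w = laurent_cumulus f" for w
      using that False cumulus_pos[of w] \<open>b \<noteq> 0\<close>
      by (cases "w = 0") (auto simp: beginning_def zero_fgroup.rep_eq)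
    then have "{w. w \<in> Poly_Mapping.keys f \<and> cumulus w = laurent_cumulus f \<and>
        beginning w = b \<and> ending w = e} = {}"
      by blast
    then show ?thesis by (simp only: corner_def sum.empty)
  qed
  moreover have "gX \<noteq> 0" "gY \<noteq> 0" "- gX \<noteq> 0" "- gY \<noteq> 0"
    using syl_eq_0_iff[of GenX 1] syl_eq_0_iff[of GenY 1] by simp_all
  ultimately show ?thesis by (simp add: f1_def f2_def f3_def f4_def)
qed

end
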